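(* Let $(S, X)$ and $(T, Y)$ be Boolean spaces with internal semigroups and let $h: (T, Y) \to \mathcal V(S, X)$ be a morphism of Boolean spaces with internal semigroups. Then there is a Boolean space with an internal semigroup $(R, Z)$ and morphisms of Boolean spaces with internal semigroups $f:(R, Z) \to (T, Y)$ and $g: (R, Z) \to (S, X)$ such that $h = \mathcal V(g) \circ f^* \circ i$.
   Context: A Boolean space is a compact Hausdorff space with a basis of clopen sets. A Boolean space with an internal semigroup (BiS) is a pair $(S,X)$ where $S$ is a semigroup densely contained (as a subset) in a Boolean space $X$, such that for each $s \in S$ there are continuous maps $\lambda_s, \rho_s : X \to X$ extending respectively the left multiplication $t \mapsto st$ and the right multiplication $t \mapsto ts$ of $S$. A morphism of BiSs $(S,X) \to (T,Y)$ is a continuous map $X \to Y$ that restricts to a semigroup homomorphism $S \to T$. For a Boolean space $X$, $\mathcal V(X)$ is the Vietoris space: the set of all closed subsets of $X$ (including $\emptyset$) with the topology generated by the sets $\Diamond U = \{C \mid C \cap U \neq \emptyset\}$ and $\Box U = \{C \mid C \subseteq U\}$, $U \subseteq X$ open. For continuous maps $f: Z\to Y$ and $g: Z \to X$, $f^*: \mathcal V(Y) \to \mathcal V(Z)$ is $C \mapsto f^{-1}(C)$, $\mathcal V(g): \mathcal V(Z) \to \mathcal V(X)$ is $C \mapsto g[C]$, and $i: Y \to \mathcal V(Y)$ is $y \mapsto \{y\}$; thus $(\mathcal V(g)\circ f^*\circ i)(y) = g[f^{-1}(\{y\})]$ for $y \in Y$. For a BiS $(S,X)$, the Vietoris of $(S,X)$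 is the BiS $\mathcal V(S,X) = (\mathcal P_{fin}(S), \mathcal V(X))$, where $\mathcal P_{fin}(S)$ is the semigroup of all finite subsets of $S$ (including $\emptyset$) under pointwise multiplication $Q_1 \cdot Q_2 = \{s_1s_2 \mid s_1 \in Q_1, s_2 \in Q_2\}$, regarded as a subset of $\mathcal V(X)$, and with the actions $\lambda_Q(C) = \bigcup_{s \in Q}\lambda_s[C]$ and $\rho_Q(C) = \bigcup_{s\in Q}\rho_s[C]$ for $Q \in \mathcal P_{fin}(S)$, $C \in \mathcal V(X)$. *)

theory Defs
  imports "HOL-Analysis.Analysis"
begin

definition boolean_space :: "'a topology \<Rightarrow> bool" where
  "boolean_space X \<longleftrightarrow>
     compact_space X \<and> Hausdorff_space X \<and>
     openin X = arbitrary union_of (\<lambda>U. openin X U \<and> closedin X U)"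

(* The multiplication is only meaningful on the subset bsemi. The semigroup may be empty. *)
record 'a bis =
  bspace :: "'a topology"
  bsemi :: "'a set"
  bmult :: "'a \<Rightarrow> 'a \<Rightarrow> 'a"

(* The continuous extensions of the translations are unique on the underlying space (the
   semigroup is dense and the space Hausdorff), so they are asserted to exist rather than
   being kept as data. *)
definition is_bis :: "'a bis \<Rightarrow> bool" where
  "is_bis A \<longleftrightarrow>
     boolean_space (bspace A) \<and>
     bsemi A \<subseteq> topspace (bspace A) \<and>
     bspace A closure_of bsemi A = topspace (bspace A) \<and>
     (\<forall>s\<in>bsemi A. \<forall>t\<in>bsemi A. bmult A s t \<in> bsemi A) \<and>
     (\<forall>s\<in>bsemi A. \<forall>t\<in>bsemi A. \<forall>u\<in>bsemi A.
        bmult A (bmult A s t) u = bmult A s (bmult A t u)) \<and>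
     (\<forall>s\<in>bsemi A.
        (\<exists>l. continuous_map (bspace A) (bspace A) l \<and> (\<forall>t\<in>bsemi A. l t = bmult A s t)) \<and>
        (\<exists>r. continuous_map (bspace A) (bspace A) r \<and> (\<forall>t\<in>bsemi A. r t = bmult A t s)))"

definition bis_morphism :: "'a bis \<Rightarrow> 'b bis \<Rightarrow> ('a \<Rightarrow> 'b) \<Rightarrow> bool" where
  "bis_morphism A B f \<longleftrightarrow>
     continuous_map (bspace A) (bspace B) f \<and>
     f ` bsemi A \<subseteq> bsemi B \<and>
     (\<forall>s\<in>bsemi A. \<forall>t\<in>bsemi A. f (bmult A s t) = bmult B (f s) (f t))"

definition vdiamond :: "'a topology \<Rightarrow> 'a set \<Rightarrow> 'a set set" where
  "vdiamond X U = {C. closedin X C \<and> C \<inter> U \<noteq> {}}"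

definition vbox :: "'a topology \<Rightarrow> 'a set \<Rightarrow> 'a set set" where
  "vbox X U = {C. closedin X C \<and> C \<subseteq> U}"

definition vietoris :: "'a topology \<Rightarrow> 'a set topology" where
  "vietoris X = topology_generated_by
     ({vdiamond X U | U. openin X U} \<union> {vbox X U | U. openin X U})"

definition vietoris_bis :: "'a bis \<Rightarrow> 'a set bis" where
  "vietoris_bis A =
     \<lparr> bspace = vietoris (bspace A),
       bsemi = {Q. finite Q \<and> Q \<subseteq> bsemi A},
       bmult = (\<lambda>P Q. {bmult A s t | s t. s \<in> P \<and> t \<in> Q}) \<rparr>"

definition vietoris_map :: "('a \<Rightarrow> 'b) \<Rightarrow> 'a set \<Rightarrow> 'b set" where
  "vietoris_map g C = g ` C"

definition vietoris_pullback :: "'a topology \<Rightarrow> ('a \<Rightarrow> 'b) \<Rightarrow> 'b set \<Rightarrow> 'a set" where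
  "vietoris_pullback Z f C = {z \<in> topspace Z. f z \<in> C}"

definition vietoris_unit :: "'a \<Rightarrow> 'a set" where
  "vietoris_unit y = {y}"

lemma topspace_vietoris: "topspace (vietoris X) = {C. closedin X C}"
proof
  show "topspace (vietoris X) \<subseteq> {C. closedin X C}"
    by (auto simp: vietoris_def vdiamond_def vbox_def)
  have "C \<in> vbox X (topspace X)" if "closedin X C" for C
    using that by (simp add: vbox_def closedin_subset)
  then show "{C. closedin X C} \<subseteq> topspace (vietoris X)"
    unfolding vietoris_def topology_generated_by_topspace by blast
qed

lemma openin_vdiamond: "openin X U \<Longrightarrow> openin (vietoris X) (vdiamond X U)"
  unfolding vietoris_def by (rule topology_generated_by_Basis) blast

lemma openin_vbox: "openin X U \<Longrightarrow> openin (vietoris X) (vbox X U)"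
  unfolding vietoris_def by (rule topology_generated_by_Basis) blast

lemma closedin_vdiamond:
  assumes "closedin X K" shows "closedin (vietoris X) (vdiamond X K)"
proof -
  have "topspace (vietoris X) - vdiamond X K = vbox X (topspace X - K)"
    using closedin_subset by (fastforce simp: topspace_vietoris vdiamond_def vbox_def)
  then show ?thesis
    using openin_vbox[of X "topspace X - K"] assms
    by (auto simp: closedin_def topspace_vietoris vdiamond_def)
qed

lemma closedin_vbox:
  assumes "closedin X K" shows "closedin (vietoris X) (vbox X K)"
proof -
  have "topspace (vietoris X) - vbox X K = vdiamond X (topspace X - K)"
    using closedin_subset by (fastforce simp: topspace_vietoris vdiamond_def vbox_def)
  then show ?thesis
    using openin_vdiamond[of X "topspace X - K"] assms
    by (auto simp: closedin_def topspace_vietoris vbox_def)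
qed

lemma vietoris_nhd:
  assumes "openin (vietoris X) W" "C \<in> W"
  shows "\<exists>U \<V>. openin X U \<and> finite \<V> \<and> (\<forall>V\<in>\<V>. openin X V) \<and>
           C \<in> vbox X U \<inter> (\<Inter>V\<in>\<V>. vdiamond X V) \<and>
           vbox X U \<inter> (\<Inter>V\<in>\<V>. vdiamond X V) \<subseteq> W"
proof -
  have "generate_topology_on ({vdiamond X U | U. openin X U} \<union> {vbox X U | U. openin X U}) W"
    using assms(1) unfolding vietoris_def by (rule openin_topology_generated_by)
  then show ?thesis using assms(2)
  proof (induction arbitrary: C)
    case Empty then show ?case by simp
  next
    case (Int W1 W2)
    have "C \<in> W1" using Int.prems by simp
    from Int.IH(1)[OF this] obtain U1 V1 where 1: "openin X U1" "finite V1" "\<forall>V\<in>V1. openin X V"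
      "C \<in> vbox X U1 \<inter> (\<Inter>V\<in>V1. vdiamond X V)" "vbox X U1 \<inter> (\<Inter>V\<in>V1. vdiamond X V) \<subseteq> W1" by metis
    have "C \<in> W2" using Int.prems by simp
    from Int.IH(2)[OF this] obtain U2 V2 where 2: "openin X U2" "finite V2" "\<forall>V\<in>V2. openin X V"
      "C \<in> vbox X U2 \<inter> (\<Inter>V\<in>V2. vdiamond X V)" "vbox X U2 \<inter> (\<Inter>V\<in>V2. vdiamond X V) \<subseteq> W2" by metis
    have "vbox X (U1 \<inter> U2) = vbox X U1 \<inter> vbox X U2"
      by (auto simp: vbox_def)
    then show ?case using 1 2
      by (intro exI[of _ "U1 \<inter> U2"] exI[of _ "V1 \<union> V2"] conjI) (simp_all add: openin_Int ball_Un INT_Un, blast+)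
  next
    case (UN K)
    then obtain k where k: "k \<in> K" "C \<in> k" by blast
    from UN.IH[OF k] obtain U \<V> where *: "openin X U" "finite \<V>" "\<forall>V\<in>\<V>. openin X V"
      "C \<in> vbox X U \<inter> (\<Inter>V\<in>\<V>. vdiamond X V)" "vbox X U \<inter> (\<Inter>V\<in>\<V>. vdiamond X V) \<subseteq> k" by metis
    then have "vbox X U \<inter> (\<Inter>V\<in>\<V>. vdiamond X V) \<subseteq> \<Union>K" using k(1) by (meson Union_upper order_trans)
    with * show ?case by blast
  next
    case (Basis s)
    then consider U where "openin X U" "s = vdiamond X U" | U where "openin X U" "s = vbox X U" by blast
    then show ?case
    proof cases
      case 1
      with Basis.prems have "closedin X C" by (simp add: vdiamond_def)
      then have "C \<in> vbox X (topspace X)" by (simp add: vbox_def closedin_subset)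
      with 1 Basis.prems show ?thesis
        by (intro exI[of _ "topspace X"] exI[of _ "{U}"]) auto
    next
      case 2
      with Basis.prems show ?thesis
        by (intro exI[of _ U] exI[of _ "{}"]) auto
    qed
  qed
qed

lemma boolean_space_clopen:
  assumes "boolean_space X" "openin X U" "x \<in> U"
  obtains K where "openin X K" "closedin X K" "x \<in> K" "K \<subseteq> U"
proof -
  from assms have "(arbitrary union_of (\<lambda>U. openin X U \<and> closedin X U)) U"
    by (metis boolean_space_def)
  then show ?thesis using assms(3) that by (auto simp: union_of_def)
qed

lemma boolean_space_clopen_set:
  assumes X: "boolean_space X" and U: "openin X U" and C: "closedin X C" "C \<subseteq> U"
  obtains K where "openin X K" "closedin X K" "C \<subseteq> K" "K \<subseteq> U"
proof -
  let ?F = "{K. openin X K \<and> closedin X K \<and> K \<subseteq> U}"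
  have "compactin X C"
    using X C by (simp add: boolean_space_def closedin_compact_space)
  moreover have "C \<subseteq> \<Union>?F"
  proof
    fix x assume "x \<in> C"
    then have "x \<in> U" using C by auto
    then obtain K where "openin X K" "closedin X K" "x \<in> K" "K \<subseteq> U"
      by (rule boolean_space_clopen[OF X U])
    then show "x \<in> \<Union>?F" by blast
  qed
  ultimately obtain F where F: "finite F" "F \<subseteq> ?F" "C \<subseteq> \<Union>F"
    using compactinD[of X C ?F] by auto
  show ?thesis
  proof (rule that[of "\<Union>F"])
    show "openin X (\<Union>F)" using F by (intro openin_Union) auto
    show "closedin X (\<Union>F)" using F by (intro closedin_Union) auto
  qed (use F in auto)
qed

lemma compact_space_vietoris:
  assumes "compact_space X" shows "compact_space (vietoris X)"
proof (rule Alexander_subbase)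
  let ?B = "{vdiamond X U | U. openin X U} \<union> {vbox X U | U. openin X U}"
  have top: "\<Union>?B = topspace (vietoris X)"
    by (simp add: vietoris_def)
  show "topology (arbitrary union_of (finite intersection_of (\<lambda>x. x \<in> ?B) relative_to \<Union>?B)) = vietoris X"
    (is "?T = _")
    unfolding topology_eq
  proof (intro allI iffI)
    fix S assume S: "openin ?T S"
    have B: "openin (vietoris X) (\<Union>?B)" unfolding top by (rule openin_topspace)
    show "openin (vietoris X) S"
      by (rule minimal_topology_subbase[OF _ B S]) (auto intro: openin_vdiamond openin_vbox)
  next
    fix S assume "openin (vietoris X) S"
    then have "generate_topology_on ?B S"
      unfolding vietoris_def by (rule openin_topology_generated_by)
    then show "openin ?T S"
    proof induction
      case (Basis s)
      then have "s \<subseteq> \<Union>?B" by (rule Union_upper)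
      with Basis show ?case unfolding openin_subbase
        by (intro arbitrary_union_of_inc relative_to_subset_inc finite_intersection_of_inc)
    qed (auto intro: openin_Union)
  qed
next
  let ?B = "{vdiamond X U | U. openin X U} \<union> {vbox X U | U. openin X U}"
  fix F assume F: "F \<subseteq> ?B" "\<Union>F = topspace (vietoris X)"
  define D where "D = {U. openin X U \<and> vdiamond X U \<in> F}"
  define C where "C = topspace X - \<Union>D"
  have "openin X (\<Union>D)" by (auto simp: D_def)
  then have C: "closedin X C" unfolding C_def by (simp add: closedin_diff)
  then have "C \<in> \<Union>F" using F by (simp add: topspace_vietoris)
  then obtain W where W: "W \<in> F" "C \<in> W" by blast
  have "C \<notin> vdiamond X U" if "openin X U" "vdiamond X U \<in> F" for U
    using that by (auto simp: vdiamond_def C_def D_def)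
  then obtain V where V: "openin X V" "W = vbox X V" using W F(1) by blast
  have "compactin X (topspace X - V)"
    using assms V by (intro closedin_compact_space) auto
  moreover have "topspace X - V \<subseteq> \<Union>D"
    using W V by (auto simp: vbox_def C_def)
  ultimately obtain E where E: "finite E" "E \<subseteq> D" "topspace X - V \<subseteq> \<Union>E"
    using compactinD[of X "topspace X - V" D] by (auto simp: D_def)
  show "\<exists>F'. finite F' \<and> F' \<subseteq> F \<and> \<Union>F' = topspace (vietoris X)"
  proof (intro exI conjI)
    show "finite (insert W (vdiamond X ` E))" using E by simp
    show "insert W (vdiamond X ` E) \<subseteq> F" using E W by (auto simp: D_def)
    show "\<Union>(insert W (vdiamond X ` E)) = topspace (vietoris X)"
    proof
      show "\<Union>(insert W (vdiamond X ` E)) \<subseteq> topspace (vietoris X)"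
        using V by (auto simp: topspace_vietoris vbox_def vdiamond_def)
      show "topspace (vietoris X) \<subseteq> \<Union>(insert W (vdiamond X ` E))"
      proof
        fix K assume "K \<in> topspace (vietoris X)"
        then have K: "closedin X K" by (simp add: topspace_vietoris)
        show "K \<in> \<Union>(insert W (vdiamond X ` E))"
        proof (cases "K \<subseteq> V")
          case True then show ?thesis using K V by (simp add: vbox_def)
        next
          case False
          then obtain x where "x \<in> K" "x \<notin> V" by blast
          then have "x \<in> \<Union>E" using E K closedin_subset by blast
          then show ?thesis using K \<open>x \<in> K\<close> by (auto simp: vdiamond_def)
        qed
      qed
    qed
  qed
qed

lemma Hausdorff_space_vietoris:
  assumes X: "boolean_space X" shows "Hausdorff_space (vietoris X)"
proof -
  have *: "\<exists>U V. openin (vietoris X) U \<and> openin (vietoris X) V \<and> C \<in> U \<and> D \<in> V \<and> disjnt U V"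
    if CD: "closedin X C" "closedin X D" and x: "x \<in> C" "x \<notin> D" for C D x
  proof -
    have "openin X (topspace X - D)" using CD by blast
    moreover have "x \<in> topspace X - D" using CD x closedin_subset by blast
    ultimately obtain K where K: "openin X K" "closedin X K" "x \<in> K" "K \<subseteq> topspace X - D"
      by (rule boolean_space_clopen[OF X])
    have "D \<in> vbox X (topspace X - K)"
      using CD K closedin_subset by (fastforce simp: vbox_def)
    moreover have "C \<in> vdiamond X K" using CD x K by (auto simp: vdiamond_def)
    moreover have "disjnt (vdiamond X K) (vbox X (topspace X - K))"
      by (auto simp: disjnt_def vdiamond_def vbox_def)
    moreover have "openin X (topspace X - K)" using K by blast
    ultimately show ?thesis using K openin_vdiamond openin_vbox by metis
  qed
  show ?thesis
    unfolding Hausdorff_space_def topspace_vietoris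
  proof (intro allI impI)
    fix C D assume CD: "C \<in> {C. closedin X C} \<and> D \<in> {C. closedin X C} \<and> C \<noteq> D"
    then consider x where "x \<in> C" "x \<notin> D" | x where "x \<in> D" "x \<notin> C" by blast
    then show "\<exists>U V. openin (vietoris X) U \<and> openin (vietoris X) V \<and> C \<in> U \<and> D \<in> V \<and> disjnt U V"
    proof cases
      case 1 then show ?thesis using * CD by blast
    next
      case 2
      with CD have "\<exists>U V. openin (vietoris X) U \<and> openin (vietoris X) V \<and> D \<in> U \<and> C \<in> V \<and> disjnt U V"
        by (intro *) auto
      then show ?thesis by (meson disjnt_sym)
    qed
  qed
qed

lemma boolean_space_vietoris:
  assumes X: "boolean_space X" shows "boolean_space (vietoris X)"
proof -
  have "openin (vietoris X) = arbitrary union_of (\<lambda>U. openin (vietoris X) U \<and> closedin (vietoris X) U)"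
    unfolding openin_topology_base_unique
  proof (intro conjI allI impI)
    fix W C assume W: "openin (vietoris X) W \<and> C \<in> W"
    then obtain U \<V> where *: "openin X U" "finite \<V>" "\<forall>V\<in>\<V>. openin X V"
      "C \<in> vbox X U \<inter> (\<Inter>V\<in>\<V>. vdiamond X V)" "vbox X U \<inter> (\<Inter>V\<in>\<V>. vdiamond X V) \<subseteq> W"
      using vietoris_nhd by meson
    have C: "closedin X C" "C \<subseteq> U" using * by (auto simp: vbox_def)
    obtain K where K: "openin X K" "closedin X K" "C \<subseteq> K" "K \<subseteq> U"
      by (rule boolean_space_clopen_set[OF X *(1) C])
    have "\<exists>L. openin X L \<and> closedin X L \<and> C \<inter> L \<noteq> {} \<and> L \<subseteq> V" if V: "V \<in> \<V>" for V
    proof -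
      have "C \<in> vdiamond X V" using * V by blast
      then obtain x where x: "x \<in> C" "x \<in> V" by (auto simp: vdiamond_def)
      have "openin X V" using * V by auto
      then obtain L where "openin X L" "closedin X L" "x \<in> L" "L \<subseteq> V"
        by (rule boolean_space_clopen[OF X _ x(2)])
      then show ?thesis using x by blast
    qed
    then obtain L where L: "\<And>V. V \<in> \<V> \<Longrightarrow> openin X (L V) \<and> closedin X (L V) \<and> C \<inter> L V \<noteq> {} \<and> L V \<subseteq> V"
      by metis
    define F where "F = insert (vbox X K) ((\<lambda>V. vdiamond X (L V)) ` \<V>)"
    have F: "finite F" "F \<noteq> {}" using * by (auto simp: F_def)
    have "\<forall>G\<in>F. openin (vietoris X) G \<and> closedin (vietoris X) G"
      using K L by (auto simp: F_def openin_vbox closedin_vbox openin_vdiamond closedin_vdiamond)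
    then have "openin (vietoris X) (\<Inter>F)" "closedin (vietoris X) (\<Inter>F)"
      using F by (auto intro: openin_Inter closedin_Inter)
    moreover have "C \<in> \<Inter>F"
      using K L C by (auto simp: F_def vbox_def vdiamond_def)
    moreover have "\<Inter>F \<subseteq> vbox X U \<inter> (\<Inter>V\<in>\<V>. vdiamond X V)"
      using K L by (fastforce simp: F_def vbox_def vdiamond_def)
    ultimately show "\<exists>B. (openin (vietoris X) B \<and> closedin (vietoris X) B) \<and> C \<in> B \<and> B \<subseteq> W"
      using *(5) by (meson order_trans)
  qed auto
  with X show ?thesis
    by (simp add: boolean_space_def compact_space_vietoris Hausdorff_space_vietoris[OF X])
qed

lemma continuous_map_vietoris_iff:
  "continuous_map Z (vietoris X) f \<longleftrightarrow>
     (\<forall>W. W \<in> {vdiamond X U | U. openin X U} \<union> {vbox X U | U. openin X U} \<longrightarrow>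
        openin Z (f -` W \<inter> topspace Z)) \<and>
     f ` topspace Z \<subseteq> topspace (vietoris X)"
  unfolding vietoris_def topology_generated_by_topspace by (rule continuous_on_generated_topo_iff)

lemma continuous_map_vietoris_Union:
  assumes X: "boolean_space X" and Q: "finite Q"
    and l: "\<And>s. s \<in> Q \<Longrightarrow> continuous_map X X (l s)"
  shows "continuous_map (vietoris X) (vietoris X) (\<lambda>C. \<Union>s\<in>Q. l s ` C)"
proof -
  have cl: "closedin X (\<Union>s\<in>Q. l s ` C)" if "closedin X C" for C
  proof (rule closedin_Union)
    fix K assume "K \<in> (\<lambda>s. l s ` C) ` Q"
    then obtain s where s: "s \<in> Q" "K = l s ` C" by blast
    have "compactin X C" using X that by (simp add: boolean_space_def closedin_compact_space)
    then have "compactin X K" using l s image_compactin by blast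
    then show "closedin X K" using X by (simp add: boolean_space_def compactin_imp_closedin)
  qed (use Q in auto)
  show ?thesis
    unfolding continuous_map_vietoris_iff
  proof (intro conjI allI impI)
    fix W assume "W \<in> {vdiamond X U | U. openin X U} \<union> {vbox X U | U. openin X U}"
    then consider U where "openin X U" "W = vdiamond X U" | U where "openin X U" "W = vbox X U" by blast
    then show "openin (vietoris X) ((\<lambda>C. \<Union>s\<in>Q. l s ` C) -` W \<inter> topspace (vietoris X))"
    proof cases
      case 1
      have "(\<lambda>C. \<Union>s\<in>Q. l s ` C) -` W \<inter> topspace (vietoris X) =
            (\<Union>s\<in>Q. vdiamond X {x \<in> topspace X. l s x \<in> U})"
        using 1 cl closedin_subset by (fastforce simp: vdiamond_def topspace_vietoris)
      moreover have "openin (vietoris X) (\<Union>s\<in>Q. vdiamond X {x \<in> topspace X. l s x \<in> U})"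
        using 1 l by (auto intro!: openin_Union openin_vdiamond openin_continuous_map_preimage)
      ultimately show ?thesis by simp
    next
      case 2
      have "(\<lambda>C. \<Union>s\<in>Q. l s ` C) -` W \<inter> topspace (vietoris X) =
            vbox X (topspace X \<inter> (\<Inter>s\<in>Q. {x \<in> topspace X. l s x \<in> U}))"
        using 2 cl closedin_subset by (fastforce simp: vbox_def topspace_vietoris)
      moreover have "openin X (topspace X \<inter> (\<Inter>s\<in>Q. {x \<in> topspace X. l s x \<in> U}))"
      proof (cases "Q = {}")
        case False
        then show ?thesis
          using 2 l Q by (intro openin_Int openin_INT2) (auto intro: openin_continuous_map_preimage)
      qed auto
      ultimately show ?thesis by (simp add: openin_vbox)
    qed
  next
    show "(\<lambda>C. \<Union>s\<in>Q. l s ` C) ` topspace (vietoris X) \<subseteq> topspace (vietoris X)"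
      using cl by (auto simp: topspace_vietoris)
  qed
qed

(* The actions of a finite set Q are the unions of the images under the actions of its elements. *)
lemma vietoris_bis_actions:
  assumes A: "is_bis A" and Q: "Q \<in> bsemi (vietoris_bis A)"
    and l: "\<And>s. s \<in> Q \<Longrightarrow> continuous_map (bspace A) (bspace A) (l s)"
           "\<And>s t. s \<in> Q \<Longrightarrow> t \<in> bsemi A \<Longrightarrow> l s t = bmult A s t"
    and r: "\<And>s. s \<in> Q \<Longrightarrow> continuous_map (bspace A) (bspace A) (r s)"
           "\<And>s t. s \<in> Q \<Longrightarrow> t \<in> bsemi A \<Longrightarrow> r s t = bmult A t s"
  shows "continuous_map (bspace (vietoris_bis A)) (bspace (vietoris_bis A)) (\<lambda>C. \<Union>s\<in>Q. l s ` C)"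
    and "\<forall>P\<in>bsemi (vietoris_bis A). (\<Union>s\<in>Q. l s ` P) = bmult (vietoris_bis A) Q P"
    and "continuous_map (bspace (vietoris_bis A)) (bspace (vietoris_bis A)) (\<lambda>C. \<Union>s\<in>Q. r s ` C)"
    and "\<forall>P\<in>bsemi (vietoris_bis A). (\<Union>s\<in>Q. r s ` P) = bmult (vietoris_bis A) P Q"
proof -
  have X: "boolean_space (bspace A)" using A by (simp add: is_bis_def)
  have fin: "finite Q" using Q by (simp add: vietoris_bis_def)
  show "continuous_map (bspace (vietoris_bis A)) (bspace (vietoris_bis A)) (\<lambda>C. \<Union>s\<in>Q. l s ` C)"
    using continuous_map_vietoris_Union[OF X fin l(1)] by (simp add: vietoris_bis_def)
  show "continuous_map (bspace (vietoris_bis A)) (bspace (vietoris_bis A)) (\<lambda>C. \<Union>s\<in>Q. r s ` C)"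
    using continuous_map_vietoris_Union[OF X fin r(1)] by (simp add: vietoris_bis_def)
  show "\<forall>P\<in>bsemi (vietoris_bis A). (\<Union>s\<in>Q. l s ` P) = bmult (vietoris_bis A) Q P"
  proof
    fix P assume "P \<in> bsemi (vietoris_bis A)"
    then have P: "P \<subseteq> bsemi A" by (simp add: vietoris_bis_def)
    have "l s ` P = bmult A s ` P" if "s \<in> Q" for s
      using P l(2)[OF that] by (intro image_cong) auto
    then have "(\<Union>s\<in>Q. l s ` P) = (\<Union>s\<in>Q. bmult A s ` P)" by simp
    then show "(\<Union>s\<in>Q. l s ` P) = bmult (vietoris_bis A) Q P"
      by (auto simp: vietoris_bis_def)
  qed
  show "\<forall>P\<in>bsemi (vietoris_bis A). (\<Union>s\<in>Q. r s ` P) = bmult (vietoris_bis A) P Q"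
  proof
    fix P assume "P \<in> bsemi (vietoris_bis A)"
    then have P: "P \<subseteq> bsemi A" by (simp add: vietoris_bis_def)
    have "r s ` P = (\<lambda>t. bmult A t s) ` P" if "s \<in> Q" for s
      using P r(2)[OF that] by (intro image_cong) auto
    then have "(\<Union>s\<in>Q. r s ` P) = (\<Union>s\<in>Q. (\<lambda>t. bmult A t s) ` P)" by simp
    then show "(\<Union>s\<in>Q. r s ` P) = bmult (vietoris_bis A) P Q"
      by (auto simp: vietoris_bis_def)
  qed
qed

lemma is_bis_vietoris_bis:
  assumes A: "is_bis A" shows "is_bis (vietoris_bis A)"
proof -
  let ?X = "bspace A" and ?S = "bsemi A" and ?V = "vietoris_bis A"
  have X: "boolean_space ?X" and S: "?S \<subseteq> topspace ?X" "?X closure_of ?S = topspace ?X"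
    and mult: "\<And>s t. s \<in> ?S \<Longrightarrow> t \<in> ?S \<Longrightarrow> bmult A s t \<in> ?S"
    and assoc: "\<And>s t u. s \<in> ?S \<Longrightarrow> t \<in> ?S \<Longrightarrow> u \<in> ?S \<Longrightarrow>
        bmult A (bmult A s t) u = bmult A s (bmult A t u)"
    using A by (auto simp: is_bis_def)
  have sub: "bsemi ?V \<subseteq> topspace (bspace ?V)"
  proof
    fix Q assume "Q \<in> bsemi ?V"
    then have "finite Q" "Q \<subseteq> topspace ?X" using S by (auto simp: vietoris_bis_def)
    moreover have "t1_space ?X" using X by (simp add: boolean_space_def Hausdorff_imp_t1_space)
    ultimately show "Q \<in> topspace (bspace ?V)"
      by (simp add: vietoris_bis_def topspace_vietoris t1_space_closedin_finite)
  qed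
  have dense: "bspace ?V closure_of bsemi ?V = topspace (bspace ?V)"
    unfolding dense_intersects_open
  proof (intro allI impI)
    fix W assume W: "openin (bspace ?V) W \<and> W \<noteq> {}"
    then obtain C where "C \<in> W" by blast
    with W obtain U \<V> where *: "openin ?X U" "finite \<V>" "\<forall>V\<in>\<V>. openin ?X V"
      "C \<in> vbox ?X U \<inter> (\<Inter>V\<in>\<V>. vdiamond ?X V)" "vbox ?X U \<inter> (\<Inter>V\<in>\<V>. vdiamond ?X V) \<subseteq> W"
      using vietoris_nhd[of ?X W C] by (auto simp: vietoris_bis_def)
    have "\<exists>s. s \<in> ?S \<inter> (U \<inter> V)" if "V \<in> \<V>" for V
    proof -
      have "openin ?X (U \<inter> V)"  using * that by auto
      moreover have "C \<in> vdiamond ?X V" "C \<in> vbox ?X U" using * that by blast+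
      then have "U \<inter> V \<noteq> {}" by (auto simp: vbox_def vdiamond_def)
      ultimately show ?thesis using S(2) unfolding dense_intersects_open by blast
    qed
    then obtain s where s: "\<And>V. V \<in> \<V> \<Longrightarrow> s V \<in> ?S \<inter> (U \<inter> V)" by metis
    have Q: "s ` \<V> \<in> bsemi ?V" using s * by (auto simp: vietoris_bis_def)
    then have "closedin ?X (s ` \<V>)" using sub by (auto simp: vietoris_bis_def topspace_vietoris)
    then have "s ` \<V> \<in> vbox ?X U \<inter> (\<Inter>V\<in>\<V>. vdiamond ?X V)"
      using s by (auto simp: vbox_def vdiamond_def)
    then show "bsemi ?V \<inter> W \<noteq> {}" using Q * by blast
  qed
  have closed: "\<forall>P\<in>bsemi ?V. \<forall>Q\<in>bsemi ?V. bmult ?V P Q \<in> bsemi ?V"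
    using mult by (auto simp: vietoris_bis_def finite_image_set2 subset_iff)
  have ass: "\<forall>P\<in>bsemi ?V. \<forall>Q\<in>bsemi ?V. \<forall>R\<in>bsemi ?V.
      bmult ?V (bmult ?V P Q) R = bmult ?V P (bmult ?V Q R)"
  proof (intro ballI)
    fix P Q R assume "P \<in> bsemi ?V" "Q \<in> bsemi ?V" "R \<in> bsemi ?V"
    then have PQR: "P \<subseteq> ?S" "Q \<subseteq> ?S" "R \<subseteq> ?S" by (auto simp: vietoris_bis_def)
    have eq: "bmult A (bmult A s t) u = bmult A s (bmult A t u)" if "s \<in> P" "t \<in> Q" "u \<in> R" for s t u
      using PQR that by (intro assoc) auto
    have "bmult ?V (bmult ?V P Q) R = (\<Union>s\<in>P. \<Union>t\<in>Q. \<Union>u\<in>R. {bmult A (bmult A s t) u})"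
      by (auto simp: vietoris_bis_def)
    also have "\<dots> = (\<Union>s\<in>P. \<Union>t\<in>Q. \<Union>u\<in>R. {bmult A s (bmult A t u)})"
      by (intro SUP_cong refl) (simp add: eq)
    also have "\<dots> = bmult ?V P (bmult ?V Q R)"
      by (auto simp: vietoris_bis_def)
    finally show "bmult ?V (bmult ?V P Q) R = bmult ?V P (bmult ?V Q R)" .
  qed
  have act: "\<forall>Q\<in>bsemi ?V.
      (\<exists>l. continuous_map (bspace ?V) (bspace ?V) l \<and> (\<forall>P\<in>bsemi ?V. l P = bmult ?V Q P)) \<and>
      (\<exists>r. continuous_map (bspace ?V) (bspace ?V) r \<and> (\<forall>P\<in>bsemi ?V. r P = bmult ?V P Q))"
  proof
    fix Q assume Q: "Q \<in> bsemi ?V"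
    then have QS: "Q \<subseteq> ?S" by (simp add: vietoris_bis_def)
    have "\<forall>s\<in>?S. \<exists>l. continuous_map ?X ?X l \<and> (\<forall>t\<in>?S. l t = bmult A s t)"
      "\<forall>s\<in>?S. \<exists>r. continuous_map ?X ?X r \<and> (\<forall>t\<in>?S. r t = bmult A t s)"
      using A by (auto simp: is_bis_def)
    then obtain l r where lr: "\<forall>s\<in>?S. continuous_map ?X ?X (l s) \<and> (\<forall>t\<in>?S. l s t = bmult A s t)"
      "\<forall>s\<in>?S. continuous_map ?X ?X (r s) \<and> (\<forall>t\<in>?S. r s t = bmult A t s)"
      by metis
    have 1: "continuous_map ?X ?X (l s)" "continuous_map ?X ?X (r s)" if "s \<in> Q" for s
      using lr QS that by auto
    have 2: "l s t = bmult A s t" "r s t = bmult A t s" if "s \<in> Q" "t \<in> ?S" for s t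
      using lr QS that by auto
    show "(\<exists>l. continuous_map (bspace ?V) (bspace ?V) l \<and> (\<forall>P\<in>bsemi ?V. l P = bmult ?V Q P)) \<and>
      (\<exists>r. continuous_map (bspace ?V) (bspace ?V) r \<and> (\<forall>P\<in>bsemi ?V. r P = bmult ?V P Q))"
      by (intro conjI exI; (rule vietoris_bis_actions[OF A Q 1(1) 2(1) 1(2) 2(2)]; assumption))
  qed
  show ?thesis
    unfolding is_bis_def
    using boolean_space_vietoris[OF X] sub dense closed ass act
    by (simp add: vietoris_bis_def)
qed

end

(* The relation Z = {(y, x). x \<in> h y} is closed in Y \<times> X because h is continuous, and the pairs
   (t, s) with t \<in> T, s \<in> h t form a subsemigroup R of T \<times> S because h is multiplicative on T. As h
   sends T to subsets of S and {y. h y meets U} is open for open U, R is dense in Z. Hence Z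
   with R is the closure of a subsemigroup in a product, and f, g are the projections. *)
theory Submission
  imports Defs
begin

text \<open>Converse of \<open>boolean_space_clopen\<close>: lets the clopen base be checked
  pointwise instead of through \<open>union_of\<close>.\<close>

lemma boolean_spaceI:
  assumes "compact_space X" "Hausdorff_space X"
    and "\<And>U x. openin X U \<Longrightarrow> x \<in> U \<Longrightarrow> \<exists>K. openin X K \<and> closedin X K \<and> x \<in> K \<and> K \<subseteq> U"
  shows "boolean_space X"
proof -
  have "openin X = arbitrary union_of (\<lambda>U. openin X U \<and> closedin X U)"
    unfolding openin_topology_base_unique using assms(3) by blast
  with assms(1,2) show ?thesis unfolding boolean_space_def by blast
qed

lemma boolean_space_prod_topology:
  assumes X: "boolean_space X" and Y: "boolean_space Y"
  shows "boolean_space (prod_topology X Y)"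
proof (rule boolean_spaceI)
  show "compact_space (prod_topology X Y)"
    using X Y by (simp add: boolean_space_def compact_space_prod_topology)
  show "Hausdorff_space (prod_topology X Y)"
    using X Y by (simp add: boolean_space_def Hausdorff_space_prod_topology)
  fix W p assume W: "openin (prod_topology X Y) W" "p \<in> W"
  obtain x y where p: "p = (x, y)" by fastforce
  then obtain U V where UV: "openin X U" "openin Y V" "x \<in> U" "y \<in> V" "U \<times> V \<subseteq> W"
    using openin_prod_topology_alt[THEN iffD1, OF W(1), rule_format, of x y] W(2) by auto
  obtain K where K: "openin X K" "closedin X K" "x \<in> K" "K \<subseteq> U"
    using boolean_space_clopen[OF X UV(1,3)] .
  obtain L where L: "openin Y L" "closedin Y L" "y \<in> L" "L \<subseteq> V"
    using boolean_space_clopen[OF Y UV(2,4)] .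
  show "\<exists>K. openin (prod_topology X Y) K \<and> closedin (prod_topology X Y) K \<and> p \<in> K \<and> K \<subseteq> W"
    using K L UV p
    by (intro exI[of _ "K \<times> L"]) (auto simp: openin_prod_Times_iff closedin_prod_Times_iff)
qed

text \<open>Closedness of \<open>C\<close> yields compactness; the traces on \<open>C\<close> of
  clopen sets of \<open>X\<close> supply the clopen base.\<close>

lemma boolean_space_subtopology:
  assumes X: "boolean_space X" and C: "closedin X C"
  shows "boolean_space (subtopology X C)"
proof (rule boolean_spaceI)
  show "compact_space (subtopology X C)"
    using X C by (simp add: boolean_space_def closedin_compact_space compact_space_subtopology)
  show "Hausdorff_space (subtopology X C)"
    using X by (simp add: boolean_space_def Hausdorff_space_subtopology)
  fix U x assume "openin (subtopology X C) U" "x \<in> U"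
  then obtain V where V: "openin X V" "U = V \<inter> C" "x \<in> V" "x \<in> C"
    by (auto simp: openin_subtopology)
  obtain K where "openin X K" "closedin X K" "x \<in> K" "K \<subseteq> V"
    using boolean_space_clopen[OF X V(1,3)] .
  then show "\<exists>K. openin (subtopology X C) K \<and> closedin (subtopology X C) K \<and> x \<in> K \<and> K \<subseteq> U"
    using V by (intro exI[of _ "K \<inter> C"]) (auto simp: openin_subtopology closedin_subtopology)
qed

lemma is_bisI:
  assumes "boolean_space (bspace A)"
    and "bsemi A \<subseteq> topspace (bspace A)"
    and "bspace A closure_of bsemi A = topspace (bspace A)"
    and "\<And>s t. s \<in> bsemi A \<Longrightarrow> t \<in> bsemi A \<Longrightarrow> bmult A s t \<in> bsemi A"
    and "\<And>s t u. s \<in> bsemi A \<Longrightarrow> t \<in> bsemi A \<Longrightarrow> u \<in> bsemi A \<Longrightarrow>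
      bmult A (bmult A s t) u = bmult A s (bmult A t u)"
    and "\<And>s. s \<in> bsemi A \<Longrightarrow>
      \<exists>l. continuous_map (bspace A) (bspace A) l \<and> (\<forall>t\<in>bsemi A. l t = bmult A s t)"
    and "\<And>s. s \<in> bsemi A \<Longrightarrow>
      \<exists>r. continuous_map (bspace A) (bspace A) r \<and> (\<forall>t\<in>bsemi A. r t = bmult A t s)"
  shows "is_bis A"
  unfolding is_bis_def by (intro conjI ballI assms)

lemma is_bisD:
  assumes "is_bis A"
  shows "boolean_space (bspace A)"
    and "bsemi A \<subseteq> topspace (bspace A)"
    and "bspace A closure_of bsemi A = topspace (bspace A)"
    and "\<And>s t. s \<in> bsemi A \<Longrightarrow> t \<in> bsemi A \<Longrightarrow> bmult A s t \<in> bsemi A"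
    and "\<And>s t u. s \<in> bsemi A \<Longrightarrow> t \<in> bsemi A \<Longrightarrow> u \<in> bsemi A \<Longrightarrow>
      bmult A (bmult A s t) u = bmult A s (bmult A t u)"
    and "\<And>s. s \<in> bsemi A \<Longrightarrow>
      \<exists>l. continuous_map (bspace A) (bspace A) l \<and> (\<forall>t\<in>bsemi A. l t = bmult A s t)"
    and "\<And>s. s \<in> bsemi A \<Longrightarrow>
      \<exists>r. continuous_map (bspace A) (bspace A) r \<and> (\<forall>t\<in>bsemi A. r t = bmult A t s)"
  using assms unfolding is_bis_def by blast+

definition bis_prod :: "'a bis \<Rightarrow> 'b bis \<Rightarrow> ('a \<times> 'b) bis" where
  "bis_prod A B =
     \<lparr> bspace = prod_topology (bspace A) (bspace B),
       bsemi = bsemi A \<times> bsemi B,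
       bmult = (\<lambda>p q. (bmult A (fst p) (fst q), bmult B (snd p) (snd q))) \<rparr>"

text \<open>Density passes to the product because the closure of a product is the product of the
  closures. Translations act coordinatewise, so pairing the coordinate extensions extends
  them.\<close>

lemma is_bis_bis_prod:
  assumes A: "is_bis A" and B: "is_bis B"
  shows "is_bis (bis_prod A B)"
proof (rule is_bisI)
  let ?P = "bis_prod A B"
  show "boolean_space (bspace ?P)"
    by (simp add: bis_prod_def boolean_space_prod_topology is_bisD(1)[OF A] is_bisD(1)[OF B])
  show "bsemi ?P \<subseteq> topspace (bspace ?P)"
    using is_bisD(2)[OF A] is_bisD(2)[OF B] by (auto simp: bis_prod_def)
  show "bspace ?P closure_of bsemi ?P = topspace (bspace ?P)"
    by (simp add: bis_prod_def closure_of_Times is_bisD(3)[OF A] is_bisD(3)[OF B])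
  show "bmult ?P p q \<in> bsemi ?P" if "p \<in> bsemi ?P" "q \<in> bsemi ?P" for p q
    using that by (auto simp: bis_prod_def is_bisD(4)[OF A] is_bisD(4)[OF B])
  show "bmult ?P (bmult ?P p q) u = bmult ?P p (bmult ?P q u)"
    if "p \<in> bsemi ?P" "q \<in> bsemi ?P" "u \<in> bsemi ?P" for p q u
    using that by (auto simp: bis_prod_def is_bisD(5)[OF A] is_bisD(5)[OF B])
next
  let ?P = "bis_prod A B"
  fix p assume "p \<in> bsemi ?P"
  then obtain s t where p: "p = (s, t)" "s \<in> bsemi A" "t \<in> bsemi B"
    by (auto simp: bis_prod_def)
  obtain l where l: "continuous_map (bspace A) (bspace A) l" "\<forall>u\<in>bsemi A. l u = bmult A s u"
    using is_bisD(6)[OF A p(2)] by blast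
  obtain l' where l': "continuous_map (bspace B) (bspace B) l'" "\<forall>u\<in>bsemi B. l' u = bmult B t u"
    using is_bisD(6)[OF B p(3)] by blast
  show "\<exists>k. continuous_map (bspace ?P) (bspace ?P) k \<and> (\<forall>q\<in>bsemi ?P. k q = bmult ?P p q)"
    using l l' p(1)
    by (intro exI[of _ "\<lambda>(x, y). (l x, l' y)"]) (simp add: bis_prod_def continuous_map_prod_top)
  obtain r where r: "continuous_map (bspace A) (bspace A) r" "\<forall>u\<in>bsemi A. r u = bmult A u s"
    using is_bisD(7)[OF A p(2)] by blast
  obtain r' where r': "continuous_map (bspace B) (bspace B) r'" "\<forall>u\<in>bsemi B. r' u = bmult B u t"
    using is_bisD(7)[OF B p(3)] by blast
  show "\<exists>k. continuous_map (bspace ?P) (bspace ?P) k \<and> (\<forall>q\<in>bsemi ?P. k q = bmult ?P q p)"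
    using r r' p(1)
    by (intro exI[of _ "\<lambda>(x, y). (r x, r' y)"]) (simp add: bis_prod_def continuous_map_prod_top)
qed

text \<open>Taking the closure of \<open>R\<close> as the space makes \<open>R\<close> dense by
  construction. \<open>bmult A\<close> can be kept as it is, since only its values on the semigroup
  matter.\<close>

definition bis_closure :: "'a bis \<Rightarrow> 'a set \<Rightarrow> 'a bis" where
  "bis_closure A R =
     \<lparr> bspace = subtopology (bspace A) (bspace A closure_of R),
       bsemi = R,
       bmult = bmult A \<rparr>"

lemma is_bis_bis_closure:
  assumes A: "is_bis A" and R: "R \<subseteq> bsemi A"
    and mult: "\<And>s t. s \<in> R \<Longrightarrow> t \<in> R \<Longrightarrow> bmult A s t \<in> R"
  shows "is_bis (bis_closure A R)"
proof (rule is_bisI)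
  let ?X = "bspace A" and ?Z = "bspace A closure_of R" and ?C = "bis_closure A R"
  have sub: "R \<subseteq> topspace ?X" using R is_bisD(2)[OF A] by (rule order_trans)
  then have RZ: "R \<subseteq> ?Z" by (rule closure_of_subset)
  show "boolean_space (bspace ?C)"
    by (simp add: bis_closure_def boolean_space_subtopology is_bisD(1)[OF A])
  show "bsemi ?C \<subseteq> topspace (bspace ?C)"
    using sub RZ by (simp add: bis_closure_def)
  show "bspace ?C closure_of bsemi ?C = topspace (bspace ?C)"
    using RZ
    by (simp add: bis_closure_def closure_of_subtopology Int_absorb1 closure_of_subset_topspace)
  show "bmult ?C s t \<in> bsemi ?C" if "s \<in> bsemi ?C" "t \<in> bsemi ?C" for s t
    using that mult by (simp add: bis_closure_def)
  show "bmult ?C (bmult ?C s t) u = bmult ?C s (bmult ?C t u)"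
    if "s \<in> bsemi ?C" "t \<in> bsemi ?C" "u \<in> bsemi ?C" for s t u
    using that R by (simp add: bis_closure_def is_bisD(5)[OF A] subset_iff)
  \<comment> \<open>The extensions are inherited from \<open>A\<close>: a continuous map sends the
    closure of \<open>R\<close> into the closure of its image, so one that preserves
    \<open>R\<close> also preserves its closure. Translations by elements of \<open>R\<close>
    preserve \<open>R\<close> by \<open>mult\<close>.\<close>
  have restrict: "continuous_map (bspace ?C) (bspace ?C) l"
    if l: "continuous_map ?X ?X l" "l ` R \<subseteq> R" for l
  proof -
    have "l ` ?Z \<subseteq> ?X closure_of (l ` R)"
      using l(1) by (rule continuous_map_image_closure_subset)
    also have "\<dots> \<subseteq> ?Z" using l(2) by (rule closure_of_mono)
    finally show ?thesis
      using l(1)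
      by (auto simp: bis_closure_def continuous_map_in_subtopology continuous_map_from_subtopology)
  qed
  fix s assume "s \<in> bsemi ?C"
  then have s: "s \<in> R" by (simp add: bis_closure_def)
  with R have sA: "s \<in> bsemi A" by blast
  obtain l where l: "continuous_map ?X ?X l" "\<forall>t\<in>bsemi A. l t = bmult A s t"
    using is_bisD(6)[OF A sA] by blast
  then have lR: "\<forall>t\<in>R. l t = bmult A s t" using R by blast
  then have "continuous_map (bspace ?C) (bspace ?C) l"
    by (intro restrict l(1)) (simp add: image_subset_iff mult s)
  then show "\<exists>l. continuous_map (bspace ?C) (bspace ?C) l \<and> (\<forall>t\<in>bsemi ?C. l t = bmult ?C s t)"
    using lR by (intro exI[of _ l]) (simp add: bis_closure_def)
  obtain r where r: "continuous_map ?X ?X r" "\<forall>t\<in>bsemi A. r t = bmult A t s"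
    using is_bisD(7)[OF A sA] by blast
  then have rR: "\<forall>t\<in>R. r t = bmult A t s" using R by blast
  then have "continuous_map (bspace ?C) (bspace ?C) r"
    by (intro restrict r(1)) (simp add: image_subset_iff mult s)
  then show "\<exists>r. continuous_map (bspace ?C) (bspace ?C) r \<and> (\<forall>t\<in>bsemi ?C. r t = bmult ?C t s)"
    using rR by (intro exI[of _ r]) (simp add: bis_closure_def)
qed

text \<open>The box sets do the work. If \<open>x\<close> is outside the closed set
  \<open>h y\<close>, a clopen \<open>K\<close> around \<open>x\<close> misses \<open>h y\<close>;
  by continuity \<open>h v\<close> still misses \<open>K\<close> for all \<open>v\<close> near
  \<open>y\<close>.\<close>

lemma closedin_vietoris_relation:
  assumes X: "boolean_space X" and h: "continuous_map Y (vietoris X) h"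
  shows "closedin (prod_topology Y X) {(y, x). y \<in> topspace Y \<and> x \<in> h y}" (is "closedin _ ?Z")
proof -
  have cl: "closedin X (h y)" if "y \<in> topspace Y" for y
    using h that by (auto simp: continuous_map_def topspace_vietoris)
  have "openin (prod_topology Y X) (topspace (prod_topology Y X) - ?Z)"
    unfolding openin_prod_topology_alt
  proof (intro allI impI)
    fix y x assume "(y, x) \<in> topspace (prod_topology Y X) - ?Z"
    then have yx: "y \<in> topspace Y" "x \<in> topspace X - h y" by auto
    have "openin X (topspace X - h y)" using cl yx by blast
    from boolean_space_clopen[OF X this yx(2)]
    obtain K where K: "openin X K" "closedin X K" "x \<in> K" "K \<subseteq> topspace X - h y" .
    \<comment> \<open>The points \<open>v\<close> with \<open>h v\<close> disjoint from
      \<open>K\<close>. Since \<open>K\<close> is closed, its complement is open and so is this box;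
      since \<open>K\<close> is open, \<open>?V \<times> K\<close> is a neighbourhood of
      \<open>(y, x)\<close>.\<close>
    let ?V = "{v \<in> topspace Y. h v \<in> vbox X (topspace X - K)}"
    have "openin X (topspace X - K)" using K by blast
    then have "openin Y ?V" by (intro openin_continuous_map_preimage[OF h] openin_vbox)
    moreover have "y \<in> ?V"
      using yx K cl[OF yx(1)] closedin_subset[OF cl[OF yx(1)]] by (auto simp: vbox_def)
    moreover have "?V \<times> K \<subseteq> topspace (prod_topology Y X) - ?Z"
      using openin_subset[OF K(1)] by (auto simp: vbox_def)
    ultimately show "\<exists>U V. openin Y U \<and> openin X V \<and> y \<in> U \<and> x \<in> V \<and>
        U \<times> V \<subseteq> topspace (prod_topology Y X) - ?Z"
      using K by blast
  qed
  moreover have "?Z \<subseteq> topspace (prod_topology Y X)"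
    using cl closedin_subset by fastforce
  ultimately show ?thesis by (simp add: closedin_def)
qed

text \<open>One inclusion is closedness of the right-hand side. For the other the diamond sets are
  used: \<open>h v\<close> keeps meeting a neighbourhood of \<open>x\<close> for \<open>v\<close>
  near \<open>y\<close>, and by density some such \<open>v\<close> lies in \<open>T\<close>.\<close>

lemma vietoris_relation_closure:
  assumes X: "boolean_space X" and h: "continuous_map Y (vietoris X) h"
    and T: "T \<subseteq> topspace Y" "Y closure_of T = topspace Y"
  shows "prod_topology Y X closure_of {(t, s). t \<in> T \<and> s \<in> h t} =
         {(y, x). y \<in> topspace Y \<and> x \<in> h y}" (is "_ closure_of ?R = ?Z")
proof
  show "prod_topology Y X closure_of ?R \<subseteq> ?Z"
    using T(1) by (intro closure_of_minimal closedin_vietoris_relation[OF X h]) auto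
  show "?Z \<subseteq> prod_topology Y X closure_of ?R"
  proof
    fix p assume p: "p \<in> ?Z"
    then obtain y x where yx: "p = (y, x)" "y \<in> topspace Y" "x \<in> h y" by auto
    have "\<exists>q. q \<in> ?R \<and> q \<in> W" if W: "p \<in> W" "openin (prod_topology Y X) W" for W
    proof -
      obtain V U where VU: "openin Y V" "openin X U" "y \<in> V" "x \<in> U" "V \<times> U \<subseteq> W"
        using openin_prod_topology_alt[THEN iffD1, OF W(2), rule_format, of y x] W(1) yx(1) by auto
      \<comment> \<open>Any \<open>t\<close> in \<open>T\<close> and in this open set has some
        \<open>s\<close> in \<open>h t \<inter> U\<close>, so \<open>(t, s)\<close> is a pair of
        \<open>?R\<close> inside \<open>V \<times> U\<close>. The point \<open>y\<close> belongs to
        it because \<open>x\<close> lies in both \<open>h y\<close> and \<open>U\<close>.\<close>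
      let ?V = "V \<inter> {v \<in> topspace Y. h v \<in> vdiamond X U}"
      have "closedin X (h y)"
        using h yx by (auto simp: continuous_map_def topspace_vietoris)
      then have "y \<in> ?V" using yx VU by (auto simp: vdiamond_def)
      moreover have "openin Y ?V"
        by (intro openin_Int openin_continuous_map_preimage[OF h] openin_vdiamond VU)
      ultimately have "T \<inter> ?V \<noteq> {}"
        using dense_intersects_open[THEN iffD1, OF T(2), rule_format, of ?V] by blast
      then show ?thesis using VU(5) by (fastforce simp: vdiamond_def)
    qed
    moreover have "p \<in> topspace (prod_topology Y X)"
      using closedin_subset[OF closedin_vietoris_relation[OF X h]] p by blast
    ultimately show "p \<in> prod_topology Y X closure_of ?R"
      by (simp only: in_closure_of) blast
  qed
qed

theorem proposition4p3:
  fixes SX :: "'a bis" and TY :: "'b bis" and h :: "'b \<Rightarrow> 'a set"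
  assumes "is_bis SX" and "is_bis TY"
    and "bis_morphism TY (vietoris_bis SX) h"
  shows "\<exists>(RZ :: ('b \<times> 'a) bis) f g.
           is_bis RZ \<and> bis_morphism RZ TY f \<and> bis_morphism RZ SX g \<and>
           (\<forall>y\<in>topspace (bspace TY).
              h y = (vietoris_map g \<circ> vietoris_pullback (bspace RZ) f \<circ> vietoris_unit) y)"
proof -
  let ?X = "bspace SX" and ?Y = "bspace TY"
  define R where "R = {(t, s). t \<in> bsemi TY \<and> s \<in> h t}"
  define RZ where "RZ = bis_closure (bis_prod TY SX) R"
  have X: "boolean_space ?X" and Y: "bsemi TY \<subseteq> topspace ?Y" "?Y closure_of bsemi TY = topspace ?Y"
    by (fact is_bisD(1)[OF assms(1)] is_bisD(2,3)[OF assms(2)])+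
  have h: "continuous_map ?Y (vietoris ?X) h"
    and hT: "\<And>t. t \<in> bsemi TY \<Longrightarrow> h t \<subseteq> bsemi SX"
    and hm: "\<And>t u. t \<in> bsemi TY \<Longrightarrow> u \<in> bsemi TY \<Longrightarrow>
      h (bmult TY t u) = {bmult SX r s | r s. r \<in> h t \<and> s \<in> h u}"
    using assms(3) by (auto simp: bis_morphism_def vietoris_bis_def)
  \<comment> \<open>Identifies the space of \<open>RZ\<close>, defined as a closure, with the full
    relation, so that the fibres of \<open>fst\<close> can be read off.\<close>
  have Z: "prod_topology ?Y ?X closure_of R = {(y, x). y \<in> topspace ?Y \<and> x \<in> h y}"
    unfolding R_def by (rule vietoris_relation_closure[OF X h Y])
  have hsub: "h y \<subseteq> topspace ?X" if "y \<in> topspace ?Y" for y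
    using h that by (auto simp: continuous_map_def topspace_vietoris dest: closedin_subset)
  have RT: "R \<subseteq> bsemi TY \<times> bsemi SX"
    using hT by (auto simp: R_def)
  \<comment> \<open>If \<open>r \<in> h t\<close> and \<open>s \<in> h u\<close>, then the product
    of \<open>r\<close> and \<open>s\<close> lies in the pointwise product of \<open>h t\<close> and
    \<open>h u\<close>, which is \<open>h (bmult TY t u)\<close> by \<open>hm\<close>.\<close>
  have "bmult (bis_prod TY SX) p q \<in> R" if "p \<in> R" "q \<in> R" for p q
    using that hm by (auto simp: R_def bis_prod_def is_bisD(4)[OF assms(2)]) blast
  then have "is_bis RZ"
    unfolding RZ_def using RT
    by (intro is_bis_bis_closure is_bis_bis_prod assms) (auto simp: bis_prod_def)
  \<comment> \<open>The projections are multiplicative because \<open>bmult\<close> of the product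
    is coordinatewise; \<open>RT\<close> places their values on \<open>R\<close> in the two
    semigroups.\<close>
  moreover have "bis_morphism RZ TY fst" "bis_morphism RZ SX snd"
    using RT
    by (auto simp: RZ_def bis_morphism_def bis_closure_def bis_prod_def
        intro: continuous_map_from_subtopology continuous_map_fst continuous_map_snd)
  moreover have "h y = (vietoris_map snd \<circ> vietoris_pullback (bspace RZ) fst \<circ> vietoris_unit) y"
    if y: "y \<in> topspace ?Y" for y
  proof -
    \<comment> \<open>The fibre over \<open>y\<close> is a copy of \<open>h y\<close>, which
      \<open>snd\<close> maps back onto \<open>h y\<close>, also when \<open>h y\<close> is empty.
      The subspace consists of the points of the closure that lie in the product, whence
      \<open>hsub\<close>.\<close>
    have "vietoris_pullback (bspace RZ) fst {y} = {y} \<times> h y"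
      using y hsub[OF y] by (auto simp: vietoris_pullback_def RZ_def bis_closure_def bis_prod_def Z)
    then show ?thesis
      by (simp add: vietoris_map_def vietoris_unit_def)
  qed
  ultimately show ?thesis by blast
qed

end
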